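(* Let $(G,+,\tau)$ be a Hausdorff locally solid commutative $\ell$-group and $A$ a solid subgroup of $G$. Let $u$ be the uniformity induced by $\tau$ and let $J=\{(a,b)\in G^2: b-a\in A_+\}$. Then the $u_J$-topology coincides with $\mathfrak{u}_A\tau$. In particular, the $u^*$-topology coincides with $\mathfrak{u}\tau$.
   Context: A subset $A$ of an $\ell$-group (lattice-ordered group) $G$ is solid if $a\in A$, $x\in G$ and $|x|\le|a|$ imply $x\in A$; a solid subgroup is a subgroup that is solid. $A_+:=\{a\in A:a\ge 0\}$. A group topology on $G$ is locally solid if $0$ has a neighbourhood base consisting of solid sets; $(G,+,\tau)$ is a locally solid commutative $\ell$-group if $(G,+)$ is a commutative $\ell$-group and $\tau$ is a locally solid group topology on it. The uniformity $u$ induced by $\tau$ (with base $\{(x,y): x-y\in U\}$, $U$ a $0$-neighbourhood) is then a lattice uniformity, i.e. makes $\vee,\wedge$ uniformly continuous, on the distributive lattice $G$. $\mathfrak{u}_A\tau$ is the locally solid group topology on $G$ having as a $0$-neighbourhood base the sets $\{x\in G:|x|\wedge a\in U\}$, where $a\in A_+$ and $U$ is a $0$-neighbourhood of $\tau$; equivalently, a net $(x_\gamma)$ converges to $x$ with respect to $\mathfrak{u}_A\tau$ iff $|x_\gamma-x|\wedge a\to 0$ in $\tau$ for every $a\in A_+$. For $A=G$ one writes $\mathfrak{u}\tau:=\mathfrak{u}_G\tau$. For $a,b\in G$ let $f_{a,b}(x):=(x\wedge b)\vee a$. For a nonempty $J\subseteq J(G):=\{(a,b)\in G^2:a\le b\}$,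 $u_J$ is the initial uniformity of the maps $f_{a,b}:G\to(G,u)$, $(a,b)\in J$, i.e. the uniformity with subbase consisting of the sets $\{(x,y)\in G^2:(f_{a,b}(x),f_{a,b}(y))\in U\}$, $(a,b)\in J$, $U\in u$. Moreover $u^*:=u_{J(G)}$. For a uniformity $v$, the $v$-topology is the topology induced by $v$. *)

theory Defs
  imports "HOL-Analysis.Analysis" "HOL-Library.Lattice_Algebras"
begin

text \<open>
  A commutative lattice-ordered group is a type of class
  \<^class>\<open>lattice_ab_group_add_abs\<close>. Several topologies and uniformities on the same group have
  to be compared, so topologies are values of type \<^typ>\<open>'a topology\<close> (with carrier the whole
  type), and a uniformity is, as in \<^class>\<open>uniform_space\<close>, the filter of its entourages.
\<close>

definition solid :: "'a::lattice_ab_group_add_abs set \<Rightarrow> bool" where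
  "solid A \<longleftrightarrow> (\<forall>a\<in>A. \<forall>x. \<bar>x\<bar> \<le> \<bar>a\<bar> \<longrightarrow> x \<in> A)"

definition solid_subgroup :: "'a::lattice_ab_group_add_abs set \<Rightarrow> bool" where
  "solid_subgroup A \<longleftrightarrow>
     0 \<in> A \<and> (\<forall>x\<in>A. \<forall>y\<in>A. x + y \<in> A) \<and> (\<forall>x\<in>A. - x \<in> A) \<and> solid A"

definition positive_part :: "'a::lattice_ab_group_add_abs set \<Rightarrow> 'a set" where
  "positive_part A = {a \<in> A. 0 \<le> a}"

definition zero_nhds :: "'a::zero topology \<Rightarrow> 'a set set" where
  "zero_nhds T = {N. \<exists>U. openin T U \<and> 0 \<in> U \<and> U \<subseteq> N}"

definition group_topology :: "'a::ab_group_add topology \<Rightarrow> bool" where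
  "group_topology T \<longleftrightarrow>
     topspace T = UNIV \<and>
     continuous_map (prod_topology T T) T (\<lambda>(x, y). x + y) \<and>
     continuous_map T T (\<lambda>x. - x)"

definition locally_solid_group_topology :: "'a::lattice_ab_group_add_abs topology \<Rightarrow> bool" where
  "locally_solid_group_topology T \<longleftrightarrow> group_topology T \<and> neighbourhood_base_at 0 solid T"

definition unbounded_base ::
    "'a::lattice_ab_group_add_abs set \<Rightarrow> 'a topology \<Rightarrow> 'a set set" where
  "unbounded_base A T = {{x. inf \<bar>x\<bar> a \<in> U} | a U. a \<in> positive_part A \<and> U \<in> zero_nhds T}"

text \<open>
  The topology written \<open>\<uu>\<^sub>A\<tau>\<close> in the literature. That it is the unique group topology with
  \<^const>\<open>unbounded_base\<close> as base of the neighbourhoods of \<open>0\<close>, and that it is locally solid, is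
  proved in \<open>unbounded_topology_unique\<close> and \<open>locally_solid_unbounded_topology\<close>.
\<close>

definition unbounded_topology ::
    "'a::lattice_ab_group_add_abs set \<Rightarrow> 'a topology \<Rightarrow> 'a topology" where
  "unbounded_topology A T =
     topology (\<lambda>W. \<forall>x\<in>W. \<exists>B\<in>unbounded_base A T. (+) x ` B \<subseteq> W)"

definition group_uniformity :: "'a::ab_group_add topology \<Rightarrow> ('a \<times> 'a) filter" where
  "group_uniformity T = (INF U\<in>zero_nhds T. principal {(x, y). x - y \<in> U})"

definition uniformity_topology :: "('a \<times> 'a) filter \<Rightarrow> 'a topology" where
  "uniformity_topology u =
     topology (\<lambda>W. \<forall>x\<in>W. \<forall>\<^sub>F (x', y) in u. x' = x \<longrightarrow> y \<in> W)"

definition truncation :: "'a::lattice \<Rightarrow> 'a \<Rightarrow> 'a \<Rightarrow> 'a" where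
  "truncation a b x = sup (inf x b) a"

text \<open>
  \<^const>\<open>filtercomap\<close> along a map squared gives the initial uniformity of that map; the infimum of
  filters is generated by the union, which makes the entourages of the single maps a subbase.
\<close>

definition truncated_uniformity ::
    "('a::lattice \<times> 'a) set \<Rightarrow> ('a \<times> 'a) filter \<Rightarrow> ('a \<times> 'a) filter" where
  "truncated_uniformity J u =
     (INF (a, b)\<in>J. filtercomap (\<lambda>(x, y). (truncation a b x, truncation a b y)) u)"

definition star_uniformity :: "('a::lattice \<times> 'a) filter \<Rightarrow> ('a \<times> 'a) filter" where
  "star_uniformity u = truncated_uniformity {(a, b). a \<le> b} u"


lemma openin_uniformity_topology:
  "openin (uniformity_topology u) W \<longleftrightarrow> (\<forall>x\<in>W. \<forall>\<^sub>F (x', y) in u. x' = x \<longrightarrow> y \<in> W)"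
proof -
  have "istopology (\<lambda>W. \<forall>x\<in>W. \<forall>\<^sub>F (x', y) in u. x' = x \<longrightarrow> y \<in> W)"
    unfolding istopology_def
  proof (intro conjI allI impI ballI)
    fix S R :: "'a set" and x
    assume "\<forall>x\<in>S. \<forall>\<^sub>F (x', y) in u. x' = x \<longrightarrow> y \<in> S"
      "\<forall>x\<in>R. \<forall>\<^sub>F (x', y) in u. x' = x \<longrightarrow> y \<in> R" "x \<in> S \<inter> R"
    then have "\<forall>\<^sub>F (x', y) in u. x' = x \<longrightarrow> y \<in> S" "\<forall>\<^sub>F (x', y) in u. x' = x \<longrightarrow> y \<in> R"
      by simp_all
    then show "\<forall>\<^sub>F (x', y) in u. x' = x \<longrightarrow> y \<in> S \<inter> R"
      by eventually_elim auto
  next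
    fix K :: "'a set set" and x
    assume K: "\<forall>S\<in>K. \<forall>x\<in>S. \<forall>\<^sub>F (x', y) in u. x' = x \<longrightarrow> y \<in> S" and "x \<in> \<Union>K"
    then obtain S where S: "S \<in> K" "x \<in> S" by blast
    with K have "\<forall>\<^sub>F (x', y) in u. x' = x \<longrightarrow> y \<in> S" by simp
    then show "\<forall>\<^sub>F (x', y) in u. x' = x \<longrightarrow> y \<in> \<Union>K"
      by eventually_elim (use S in auto)
  qed
  then show ?thesis by (simp add: uniformity_topology_def)
qed

lemma zero_nhds_UNIV: "topspace T = UNIV \<Longrightarrow> UNIV \<in> zero_nhds T"
  unfolding zero_nhds_def using openin_topspace by fastforce

lemma zero_nhds_Int: "U \<in> zero_nhds T \<Longrightarrow> V \<in> zero_nhds T \<Longrightarrow> U \<inter> V \<in> zero_nhds T"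
  unfolding zero_nhds_def by blast

lemma zero_nhds_mono: "U \<in> zero_nhds T \<Longrightarrow> U \<subseteq> V \<Longrightarrow> V \<in> zero_nhds T"
  unfolding zero_nhds_def by blast

lemma zero_in_zero_nhds: "U \<in> zero_nhds T \<Longrightarrow> 0 \<in> U"
  unfolding zero_nhds_def by blast

lemma zero_nhds_solid:
  assumes "locally_solid_group_topology T" "U \<in> zero_nhds T"
  obtains V where "V \<in> zero_nhds T" "solid V" "V \<subseteq> U"
  using assms
  unfolding locally_solid_group_topology_def neighbourhood_base_at_def zero_nhds_def mem_Collect_eq
  by (metis subset_trans)

lemma zero_nhds_add:
  assumes "group_topology T" "U \<in> zero_nhds T"
  obtains V where "V \<in> zero_nhds T" "\<And>x y. x \<in> V \<Longrightarrow> y \<in> V \<Longrightarrow> x + y \<in> U"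
proof -
  obtain W where W: "openin T W" "0 \<in> W" "W \<subseteq> U"
    using assms(2) by (auto simp: zero_nhds_def)
  have T: "topspace T = UNIV" and c: "continuous_map (prod_topology T T) T (\<lambda>(x, y). x + y)"
    using assms(1) by (auto simp: group_topology_def)
  have "openin (prod_topology T T) {p. (case p of (x, y) \<Rightarrow> x + y) \<in> W}"
    using openin_continuous_map_preimage[OF c W(1)] T by simp
  moreover have "(0, 0) \<in> {p. (case p of (x, y) \<Rightarrow> x + y) \<in> W}" using W by simp
  ultimately have "\<exists>V1 V2. openin T V1 \<and> openin T V2 \<and> 0 \<in> V1 \<and> 0 \<in> V2 \<and>
      V1 \<times> V2 \<subseteq> {p. (case p of (x, y) \<Rightarrow> x + y) \<in> W}"
    unfolding openin_prod_topology_alt by simp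
  then obtain V1 V2 where V: "openin T V1" "openin T V2" "0 \<in> V1" "0 \<in> V2"
    "V1 \<times> V2 \<subseteq> {p. (case p of (x, y) \<Rightarrow> x + y) \<in> W}"
    by blast
  then have "V1 \<inter> V2 \<in> zero_nhds T"
    unfolding zero_nhds_def using openin_Int[OF V(1,2)] by blast
  moreover have "x + y \<in> U" if "x \<in> V1 \<inter> V2" "y \<in> V1 \<inter> V2" for x y
    using that V(5) W(3) by auto
  ultimately show ?thesis using that by blast
qed

lemma openin_group_topology:
  assumes "group_topology T"
  shows "openin T W \<longleftrightarrow> (\<forall>x\<in>W. \<exists>B\<in>zero_nhds T. (+) x ` B \<subseteq> W)"
proof -
  have T: "topspace T = UNIV" and c: "continuous_map (prod_topology T T) T (\<lambda>(x, y). x + y)"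
    using assms by (auto simp: group_topology_def)
  have ct: "continuous_map T T ((+) x)" for x
  proof -
    have "continuous_map T (prod_topology T T) (\<lambda>y. (x, y))"
      using T by (auto intro!: continuous_map_pairedI)
    from continuous_map_compose[OF this c] show ?thesis by (simp add: o_def)
  qed
  have pre: "openin T ((+) x -` V)" if "openin T V" for x V
    using openin_continuous_map_preimage[OF ct that, of x] T by (simp add: vimage_def)
  show ?thesis
  proof
    assume W: "openin T W"
    show "\<forall>x\<in>W. \<exists>B\<in>zero_nhds T. (+) x ` B \<subseteq> W"
    proof
      fix x assume "x \<in> W"
      then have "(+) x -` W \<in> zero_nhds T"
        unfolding zero_nhds_def using pre[OF W, of x]
        by (auto intro!: exI[of _ "(+) x -` W"])
      then show "\<exists>B\<in>zero_nhds T. (+) x ` B \<subseteq> W" by blast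
    qed
  next
    assume *: "\<forall>x\<in>W. \<exists>B\<in>zero_nhds T. (+) x ` B \<subseteq> W"
    show "openin T W"
    proof (subst openin_subopen, intro ballI)
      fix x assume "x \<in> W"
      with * obtain B where "B \<in> zero_nhds T" "(+) x ` B \<subseteq> W" by blast
      then obtain U where U: "openin T U" "0 \<in> U" "(+) x ` U \<subseteq> W"
        by (auto simp: zero_nhds_def)
      have "(+) (- x) -` U \<subseteq> W"
      proof
        fix y assume "y \<in> (+) (- x) -` U"
        then have "x + (- x + y) \<in> W" using U by blast
        then show "y \<in> W" by simp
      qed
      then show "\<exists>V. openin T V \<and> x \<in> V \<and> V \<subseteq> W"
        using pre[OF U(1), of "- x"] U(2) by (intro exI[of _ "(+) (- x) -` U"]) auto
    qed
  qed
qed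

context
  fixes A :: "'a::lattice_ab_group_add_abs set" and T :: "'a topology"
  assumes A: "solid_subgroup A" and T: "locally_solid_group_topology T"
begin

private lemma topspace_T: "topspace T = UNIV"
  using T by (simp add: locally_solid_group_topology_def group_topology_def)

private lemma inf_add_le:
  fixes x y a :: 'a
  assumes "0 \<le> a"
  shows "inf (\<bar>x + y\<bar>) a \<le> inf (\<bar>x\<bar>) a + inf (\<bar>y\<bar>) a"
proof -
  have "inf (\<bar>x\<bar>) a + inf (\<bar>y\<bar>) a = inf (inf (\<bar>x\<bar> + \<bar>y\<bar>) (a + \<bar>y\<bar>)) (inf (\<bar>x\<bar> + a) (a + a))"
    by (simp add: add_inf_distrib_left add_inf_distrib_right)
  moreover have "inf (\<bar>x + y\<bar>) a \<le> \<bar>x\<bar> + \<bar>y\<bar>"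
    using abs_triangle_ineq by (rule le_infI1)
  moreover have "inf (\<bar>x + y\<bar>) a \<le> a + \<bar>y\<bar>" "inf (\<bar>x + y\<bar>) a \<le> \<bar>x\<bar> + a" "inf (\<bar>x + y\<bar>) a \<le> a + a"
    by (rule le_infI2, simp add: assms)+
  ultimately show ?thesis by simp
qed

private lemma base_solid_refine:
  assumes "B \<in> unbounded_base A T"
  obtains B' where "B' \<in> unbounded_base A T" "solid B'" "B' \<subseteq> B"
    "\<And>x y. x \<in> B' \<Longrightarrow> y \<in> B' \<Longrightarrow> x + y \<in> B"
proof -
  obtain a U where aU: "a \<in> positive_part A" "U \<in> zero_nhds T" "B = {x. inf (\<bar>x\<bar>) a \<in> U}"
    using assms by (auto simp: unbounded_base_def)
  have a: "0 \<le> a" using aU by (simp add: positive_part_def)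
  obtain V where V: "V \<in> zero_nhds T" "solid V" "V \<subseteq> U"
    using zero_nhds_solid[OF T aU(2)] .
  obtain W where W: "W \<in> zero_nhds T" "\<And>x y. x \<in> W \<Longrightarrow> y \<in> W \<Longrightarrow> x + y \<in> V"
    using zero_nhds_add[OF _ V(1)] T unfolding locally_solid_group_topology_def by metis
  obtain S where S: "S \<in> zero_nhds T" "solid S" "S \<subseteq> W"
    using zero_nhds_solid[OF T W(1)] .
  let ?B' = "{x. inf (\<bar>x\<bar>) a \<in> S}"
  have nn: "0 \<le> inf (\<bar>x\<bar>) a" for x :: 'a using a by simp
  have "?B' \<in> unbounded_base A T" using S aU by (auto simp: unbounded_base_def)
  moreover have "solid ?B'"
    unfolding solid_def
  proof (intro ballI allI impI)
    fix b x assume b: "b \<in> ?B'" and le: "\<bar>x\<bar> \<le> \<bar>b\<bar>"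
    have "(\<bar>inf (\<bar>x\<bar>) a\<bar>) \<le> (\<bar>inf (\<bar>b\<bar>) a\<bar>)"
      using le nn[of x] nn[of b] by (simp add: le_infI1)
    then show "x \<in> ?B'" using S(2) b unfolding solid_def by blast
  qed
  moreover have add: "x + y \<in> B" if "x \<in> ?B'" "y \<in> ?B'" for x y
  proof -
    have "inf (\<bar>x\<bar>) a + inf (\<bar>y\<bar>) a \<in> V" using that S W by blast
    moreover have "(\<bar>inf (\<bar>x + y\<bar>) a\<bar>) \<le> \<bar>inf (\<bar>x\<bar>) a + inf (\<bar>y\<bar>) a\<bar>"
      using inf_add_le[OF a, of x y] nn add_nonneg_nonneg[OF nn nn]
      by (metis abs_of_nonneg)
    ultimately show ?thesis using V unfolding solid_def aU(3) by blast
  qed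
  moreover have "?B' \<subseteq> B"
  proof
    fix x assume "x \<in> ?B'"
    moreover have "0 \<in> ?B'" using a zero_in_zero_nhds[OF S(1)] by (simp add: inf_absorb1)
    ultimately show "x \<in> B" using add[of x 0] by simp
  qed
  ultimately show ?thesis using that by blast
qed

private lemma base_Int:
  assumes "B \<in> unbounded_base A T" "C \<in> unbounded_base A T"
  obtains D where "D \<in> unbounded_base A T" "D \<subseteq> B" "D \<subseteq> C"
proof -
  obtain a U where aU: "a \<in> positive_part A" "U \<in> zero_nhds T" "B = {x. inf (\<bar>x\<bar>) a \<in> U}"
    using assms by (auto simp: unbounded_base_def)
  obtain b V where bV: "b \<in> positive_part A" "V \<in> zero_nhds T" "C = {x. inf (\<bar>x\<bar>) b \<in> V}"
    using assms by (auto simp: unbounded_base_def)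
  obtain S where S: "S \<in> zero_nhds T" "solid S" "S \<subseteq> U \<inter> V"
    using zero_nhds_solid[OF T zero_nhds_Int[OF aU(2) bV(2)]] .
  have ab: "0 \<le> a" "0 \<le> b" using aU bV by (auto simp: positive_part_def)
  have "a + b \<in> positive_part A"
    using aU bV A by (auto simp: positive_part_def solid_subgroup_def)
  then have D: "{x. inf (\<bar>x\<bar>) (a + b) \<in> S} \<in> unbounded_base A T"
    using S by (auto simp: unbounded_base_def)
  have key: "inf (\<bar>x\<bar>) c \<in> S" if "inf (\<bar>x\<bar>) (a + b) \<in> S" "0 \<le> c" "c \<le> a + b" for x c
  proof -
    have "inf (\<bar>x\<bar>) c \<le> inf (\<bar>x\<bar>) (a + b)" using that by (simp add: le_infI2)
    then have "(\<bar>inf (\<bar>x\<bar>) c\<bar>) \<le> (\<bar>inf (\<bar>x\<bar>) (a + b)\<bar>)"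
      using that ab by simp
    then show ?thesis using S(2) that(1) unfolding solid_def by blast
  qed
  have "a \<le> a + b" "b \<le> a + b" using ab by simp_all
  then show ?thesis
    using key[of _ a] key[of _ b] ab S(3) by (intro that[OF D]) (auto simp: aU(3) bV(3))
qed

private lemma base_nonempty: "\<exists>B. B \<in> unbounded_base A T"
  using A zero_nhds_UNIV[OF topspace_T]
  by (auto simp: unbounded_base_def positive_part_def solid_subgroup_def)

private lemma zero_in_base: "B \<in> unbounded_base A T \<Longrightarrow> 0 \<in> B"
  using zero_in_zero_nhds by (auto simp: unbounded_base_def positive_part_def inf_absorb1)

lemma openin_unbounded_topology:
  "openin (unbounded_topology A T) W \<longleftrightarrow> (\<forall>x\<in>W. \<exists>B\<in>unbounded_base A T. (+) x ` B \<subseteq> W)"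
proof -
  have "istopology (\<lambda>W. \<forall>x\<in>W. \<exists>B\<in>unbounded_base A T. (+) x ` B \<subseteq> W)"
    unfolding istopology_def
  proof (intro conjI allI impI ballI)
    fix S R :: "'a set" and x
    assume "\<forall>x\<in>S. \<exists>B\<in>unbounded_base A T. (+) x ` B \<subseteq> S"
      "\<forall>x\<in>R. \<exists>B\<in>unbounded_base A T. (+) x ` B \<subseteq> R" "x \<in> S \<inter> R"
    then obtain B C where BC: "B \<in> unbounded_base A T" "C \<in> unbounded_base A T"
      "(+) x ` B \<subseteq> S" "(+) x ` C \<subseteq> R" by blast
    obtain D where "D \<in> unbounded_base A T" "D \<subseteq> B" "D \<subseteq> C"
      using base_Int[OF BC(1,2)] .
    then show "\<exists>B\<in>unbounded_base A T. (+) x ` B \<subseteq> S \<inter> R" using BC by blast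
  next
    fix K :: "'a set set" and x
    assume "\<forall>S\<in>K. \<forall>x\<in>S. \<exists>B\<in>unbounded_base A T. (+) x ` B \<subseteq> S" "x \<in> \<Union>K"
    then obtain S B where "S \<in> K" "B \<in> unbounded_base A T" "(+) x ` B \<subseteq> S"
      by (meson UnionE)
    then show "\<exists>B\<in>unbounded_base A T. (+) x ` B \<subseteq> \<Union>K"
      by (meson Union_upper subset_trans)
  qed
  then show ?thesis by (simp add: unbounded_topology_def)
qed

private lemma openD:
  assumes "openin (unbounded_topology A T) W" "x \<in> W"
  obtains B where "B \<in> unbounded_base A T" "(+) x ` B \<subseteq> W"
  using assms unfolding openin_unbounded_topology by meson

private lemma openD0:
  assumes "openin (unbounded_topology A T) W" "0 \<in> W"
  obtains B where "B \<in> unbounded_base A T" "B \<subseteq> W"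
proof -
  obtain B where "B \<in> unbounded_base A T" "(+) 0 ` B \<subseteq> W"
    using openD[OF assms] .
  then show ?thesis using that by (simp add: image_subset_iff subset_iff)
qed

lemma zero_nhds_unbounded_topology:
  "N \<in> zero_nhds (unbounded_topology A T) \<longleftrightarrow> (\<exists>B\<in>unbounded_base A T. B \<subseteq> N)"
proof
  assume "N \<in> zero_nhds (unbounded_topology A T)"
  then obtain U where "openin (unbounded_topology A T) U" "0 \<in> U" "U \<subseteq> N"
    by (auto simp: zero_nhds_def)
  then show "\<exists>B\<in>unbounded_base A T. B \<subseteq> N"
    by (meson openD0 subset_trans)
next
  assume "\<exists>B\<in>unbounded_base A T. B \<subseteq> N"
  then obtain B where B: "B \<in> unbounded_base A T" "B \<subseteq> N" by blast
  define U where "U = {x. \<exists>C\<in>unbounded_base A T. (+) x ` C \<subseteq> N}"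
  have "openin (unbounded_topology A T) U"
    unfolding openin_unbounded_topology
  proof
    fix x assume "x \<in> U"
    then obtain C where C: "C \<in> unbounded_base A T" "(+) x ` C \<subseteq> N" by (auto simp: U_def)
    obtain D where D: "D \<in> unbounded_base A T" "\<And>y z. y \<in> D \<Longrightarrow> z \<in> D \<Longrightarrow> y + z \<in> C"
      using base_solid_refine[OF C(1)] by metis
    have "x + y \<in> U" if "y \<in> D" for y
    proof -
      have "(+) (x + y) ` D \<subseteq> N" using C(2) D(2)[OF that] by (auto simp: add.assoc)
      then show ?thesis unfolding U_def using D by blast
    qed
    then show "\<exists>B\<in>unbounded_base A T. (+) x ` B \<subseteq> U" using D by blast
  qed
  moreover have "0 \<in> U" using B by (auto simp: U_def)
  moreover have "U \<subseteq> N"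
  proof
    fix x assume "x \<in> U"
    then obtain C where "C \<in> unbounded_base A T" "(+) x ` C \<subseteq> N" by (auto simp: U_def)
    then have "x + 0 \<in> N" using zero_in_base by blast
    then show "x \<in> N" by simp
  qed
  ultimately show "N \<in> zero_nhds (unbounded_topology A T)" by (auto simp: zero_nhds_def)
qed

lemma locally_solid_unbounded_topology:
  "locally_solid_group_topology (unbounded_topology A T)"
proof -
  let ?S = "unbounded_topology A T"
  have top: "topspace ?S = UNIV"
  proof -
    have "openin ?S UNIV" unfolding openin_unbounded_topology using base_nonempty by blast
    then show ?thesis using openin_subset by blast
  qed
  have nb: "\<exists>U. openin ?S U \<and> x \<in> U \<and> U \<subseteq> (+) x ` B" if "B \<in> unbounded_base A T" for x B
  proof -
    have "B \<in> zero_nhds ?S"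
      unfolding zero_nhds_unbounded_topology using that by (meson subset_refl)
    then obtain U where U: "openin ?S U" "0 \<in> U" "U \<subseteq> B"
      unfolding zero_nhds_def mem_Collect_eq by (elim exE conjE)
    have "openin ?S ((+) x ` U)"
      unfolding openin_unbounded_topology
    proof
      fix y assume "y \<in> (+) x ` U"
      then obtain z where z: "z \<in> U" "y = x + z" by blast
      then obtain C where "C \<in> unbounded_base A T" "(+) z ` C \<subseteq> U"
        using openD[OF U(1)] by blast
      then show "\<exists>C\<in>unbounded_base A T. (+) y ` C \<subseteq> (+) x ` U"
        using z by (intro bexI[of _ C]) (auto simp: add.assoc)
    qed
    then show ?thesis using U by (intro exI[of _ "(+) x ` U"]) (auto intro: image_eqI[of _ _ 0])
  qed
  have add: "continuous_map (prod_topology ?S ?S) ?S (\<lambda>(x, y). x + y)"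
    unfolding continuous_map_def
  proof (intro conjI allI impI)
    fix W assume W: "openin ?S W"
    show "openin (prod_topology ?S ?S)
        {p \<in> topspace (prod_topology ?S ?S). (case p of (x, y) \<Rightarrow> x + y) \<in> W}"
      unfolding openin_prod_topology_alt
    proof (intro allI impI)
      fix x y
      assume "(x, y) \<in> {p \<in> topspace (prod_topology ?S ?S). (case p of (x, y) \<Rightarrow> x + y) \<in> W}"
      then have "x + y \<in> W" by simp
      then obtain B where B: "B \<in> unbounded_base A T" "(+) (x + y) ` B \<subseteq> W"
        using openD[OF W] by blast
      obtain D where D: "D \<in> unbounded_base A T" "\<And>y z. y \<in> D \<Longrightarrow> z \<in> D \<Longrightarrow> y + z \<in> B"
        using base_solid_refine[OF B(1)] by metis
      obtain U V where UV: "openin ?S U" "x \<in> U" "U \<subseteq> (+) x ` D"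
        "openin ?S V" "y \<in> V" "V \<subseteq> (+) y ` D"
        using nb[OF D(1)] by meson
      have "p + q \<in> W" if pq: "p \<in> U" "q \<in> V" for p q
      proof -
        obtain r where "r \<in> D" "p = x + r"
          using subsetD[OF UV(3) pq(1)] by (elim imageE)
        moreover obtain s where "s \<in> D" "q = y + s"
          using subsetD[OF UV(6) pq(2)] by (elim imageE)
        ultimately have "p + q = (x + y) + (r + s)" "r + s \<in> B"
          using D by (simp_all add: algebra_simps)
        then show ?thesis using B by auto
      qed
      then show "\<exists>U V. openin ?S U \<and> openin ?S V \<and> x \<in> U \<and> y \<in> V \<and> U \<times> V \<subseteq>
          {p \<in> topspace (prod_topology ?S ?S). (case p of (x, y) \<Rightarrow> x + y) \<in> W}"
        using UV top by (intro exI[of _ U] exI[of _ V]) auto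
    qed
  qed (simp add: top)
  have minus: "continuous_map ?S ?S (\<lambda>x. - x)"
    unfolding continuous_map_def
  proof (intro conjI allI impI)
    fix W assume W: "openin ?S W"
    have "\<exists>B\<in>unbounded_base A T. (+) x ` B \<subseteq> {x. - x \<in> W}" if x: "- x \<in> W" for x
    proof -
      obtain B where B: "B \<in> unbounded_base A T" "(+) (- x) ` B \<subseteq> W"
        using openD[OF W x] .
      have "- y \<in> B" if "y \<in> B" for y
        using B(1) that by (auto simp: unbounded_base_def)
      then have "(+) x ` B \<subseteq> {x. - x \<in> W}" using B(2) by force
      then show ?thesis using B(1) by blast
    qed
    then show "openin ?S {x \<in> topspace ?S. - x \<in> W}"
      unfolding openin_unbounded_topology top by simp
  qed (simp add: top)
  have "neighbourhood_base_at 0 solid ?S"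
    unfolding neighbourhood_base_at_def
  proof (intro allI impI)
    fix W assume "openin ?S W \<and> 0 \<in> W"
    then obtain B where B: "B \<in> unbounded_base A T" "B \<subseteq> W"
      by (meson openD0)
    obtain D where D: "D \<in> unbounded_base A T" "solid D" "D \<subseteq> B"
      using base_solid_refine[OF B(1)] by metis
    then have "D \<in> zero_nhds ?S"
      unfolding zero_nhds_unbounded_topology by (meson subset_refl)
    then obtain U where "openin ?S U" "0 \<in> U" "U \<subseteq> D"
      unfolding zero_nhds_def mem_Collect_eq by (elim exE conjE)
    then show "\<exists>U V. openin ?S U \<and> solid V \<and> 0 \<in> U \<and> U \<subseteq> V \<and> V \<subseteq> W"
      using D B by (meson subset_trans)
  qed
  then show ?thesis
    using top add minus by (simp add: locally_solid_group_topology_def group_topology_def)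
qed

lemma unbounded_topology_unique:
  assumes "group_topology S"
    and "\<And>N. N \<in> zero_nhds S \<longleftrightarrow> (\<exists>B\<in>unbounded_base A T. B \<subseteq> N)"
  shows "S = unbounded_topology A T"
proof -
  have "zero_nhds S = zero_nhds (unbounded_topology A T)"
    by (intro set_eqI) (simp only: assms(2) zero_nhds_unbounded_topology)
  moreover have "group_topology (unbounded_topology A T)"
    using locally_solid_unbounded_topology by (simp add: locally_solid_group_topology_def)
  ultimately show ?thesis
    unfolding topology_eq by (simp only: openin_group_topology assms(1) simp_thms)
qed

end

end

theory Submission
  imports Defs
begin

text \<open>
  Near a point \<open>x\<close> the two truncations to \<open>[x, x + a]\<close> and \<open>[x - a, x]\<close> control
  \<open>\<bar>y - x\<bar> \<and> a\<close>, because they send \<open>y\<close> to \<open>x + (y - x)\<^sup>+ \<and> a\<close> and \<open>x - (y - x)\<^sup>- \<and> a\<close>.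
  Conversely, every truncation to \<open>[a, b]\<close> is nonexpansive with values in \<open>[a, b]\<close>, so it moves
  \<open>x\<close> and \<open>y\<close> to points at distance at most \<open>\<bar>x - y\<bar> \<and> (b - a)\<close>.
\<close>

section \<open>Lattice-group identities and inequalities for truncations\<close>

text \<open>The identity \<open>w + z = inf w z + sup w z\<close> recovers \<open>w\<close> from its
  meet and join with \<open>z\<close>. It bounds both \<open>x\<close> and \<open>y\<close>, hence
  their join, by \<open>?u - z + sup ?s z\<close>; the same identity for the join turns this into
  the claim.\<close>

lemma lattice_group_inf_sup_distrib:
  fixes x y z :: "'a::lattice_ab_group_add"
  shows "inf (sup x y) z = sup (inf x z) (inf y z)"
proof (rule order.antisym)
  let ?s = "sup x y" and ?u = "sup (inf x z) (inf y z)"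
  have "w \<le> ?u - z + sup ?s z" if "w \<le> ?s" "inf w z \<le> ?u" for w
  proof -
    have "w = inf w z - z + sup w z"
      using add_eq_inf_sup[of w z] by (simp add: algebra_simps)
    also have "\<dots> \<le> ?u - z + sup ?s z"
      using that by (intro add_mono diff_right_mono sup_mono order.refl)
    finally show ?thesis .
  qed
  then have "?s \<le> ?u - z + sup ?s z" by simp
  then show "inf ?s z \<le> ?u"
    using add_eq_inf_sup[of ?s z] by (simp add: algebra_simps)
qed (simp add: le_infI1 le_infI2)

text \<open>By translation invariance the right side is a meet of four sums; one is
  \<open>x + y\<close>, and each of the other three is at least \<open>a\<close>.\<close>

lemma inf_add_subadditive:
  fixes x y a :: "'a::lattice_ab_group_add"
  assumes "0 \<le> x" "0 \<le> y" "0 \<le> a"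
  shows "inf (x + y) a \<le> inf x a + inf y a"
proof -
  have "inf x a + inf y a = inf (inf (x + y) (a + y)) (inf (x + a) (a + a))"
    by (simp add: add_inf_distrib_left add_inf_distrib_right)
  moreover have "inf (x + y) a \<le> a + y" "inf (x + y) a \<le> x + a" "inf (x + y) a \<le> a + a"
    by (rule le_infI2, simp add: assms)+
  ultimately show ?thesis by simp
qed

lemma truncation_minus_lower:
  fixes x y a :: "'a::lattice_ab_group_add"
  assumes "0 \<le> a"
  shows "truncation x (x + a) y - x = inf (pprt (y - x)) a"
proof -
  have "truncation x (x + a) y - x = sup (inf (y - x) a) 0"
    \<comment> \<open>Subtraction is kept as addition of \<open>- x\<close>, so that the translation
      laws of \<open>inf\<close> and \<open>sup\<close> apply.\<close>
    by (simp add: truncation_def add_inf_distrib_right add_sup_distrib_right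
        diff_conv_add_uminus del: add_uminus_conv_diff)
  then show ?thesis
    using assms by (simp add: pprt_def lattice_group_inf_sup_distrib inf_absorb1)
qed

text \<open>Negation exchanges \<open>inf\<close> and \<open>sup\<close>, which yields the outer
  meet with \<open>a\<close> directly, without distributivity.\<close>

lemma upper_minus_truncation:
  fixes x y a :: "'a::lattice_ab_group_add"
  shows "x - truncation (x - a) x y = inf (pprt (x - y)) a"
  by (simp add: truncation_def pprt_def diff_conv_add_uminus add_inf_distrib_left
      add_sup_distrib_left del: add_uminus_conv_diff)

lemma abs_inf_le_truncations:
  fixes x y a :: "'a::lattice_ab_group_add_abs"
  assumes "0 \<le> a"
  shows "inf (\<bar>y - x\<bar>) a \<le> (truncation x (x + a) y - x) + (x - truncation (x - a) x y)"
proof -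
  have "\<bar>y - x\<bar> = pprt (y - x) + pprt (x - y)"
    using abs_prts[of "y - x"] pprt_neg[of "y - x"] by simp
  then show ?thesis
    unfolding truncation_minus_lower[OF assms] upper_minus_truncation
    using inf_add_subadditive[OF zero_le_pprt zero_le_pprt assms] by simp
qed

text \<open>Shifting the argument by \<open>|x - y|\<close> shifts the truncation by at most the
  same amount, because the bounds \<open>a\<close> and \<open>b\<close> only grow when shifted too.
  The bound \<open>b - a\<close> holds because all values lie between \<open>a\<close> and
  \<open>b\<close>.\<close>

lemma truncation_diff_le:
  fixes a b x y :: "'a::lattice_ab_group_add_abs"
  assumes "a \<le> b"
  shows "\<bar>truncation a b x - truncation a b y\<bar> \<le> inf (\<bar>x - y\<bar>) (b - a)"
proof -
  \<comment> \<open>Stated for general \<open>p\<close>, \<open>q\<close> to serve both orders of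
    \<open>x\<close> and \<open>y\<close>, as the absolute value requires.\<close>
  have "truncation a b p - truncation a b q \<le> \<bar>x - y\<bar>" if "p - q \<le> \<bar>x - y\<bar>" for p q
  proof -
    let ?d = "\<bar>x - y\<bar>"
    have "p \<le> q + ?d" using that by (simp add: algebra_simps)
    then have "truncation a b p \<le> sup (inf (q + ?d) (b + ?d)) (a + ?d)"
      unfolding truncation_def by (intro sup_mono inf_mono) simp_all
    also have "\<dots> = truncation a b q + ?d"
      by (simp add: truncation_def add_inf_distrib_right add_sup_distrib_right)
    finally show ?thesis by (simp add: algebra_simps)
  qed
  moreover have "x - y \<le> \<bar>x - y\<bar>" "y - x \<le> \<bar>x - y\<bar>"
    using abs_ge_self[of "x - y"] abs_ge_self[of "y - x"] by (simp_all only: abs_minus_commute)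
  moreover have "truncation a b p - truncation a b q \<le> b - a" for p q
    using assms by (intro diff_mono) (simp_all add: truncation_def)
  ultimately show ?thesis
    by (intro le_infI abs_leI) simp_all
qed

lemma truncation_lower [simp]: "a \<le> b \<Longrightarrow> truncation a b a = a"
  by (simp add: truncation_def inf_absorb1)

lemma truncation_upper [simp]: "a \<le> b \<Longrightarrow> truncation a b b = b"
  by (simp add: truncation_def sup_absorb1)

lemma solidD: "solid A \<Longrightarrow> a \<in> A \<Longrightarrow> \<bar>x\<bar> \<le> \<bar>a\<bar> \<Longrightarrow> x \<in> A"
  by (auto simp: solid_def)

section \<open>Group uniformities and their topologies\<close>

text \<open>Neighbourhoods of \<open>0\<close> are closed under intersection, so the infimum is
  directed and a single neighbourhood suffices.\<close>

lemma eventually_group_uniformity: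
  assumes "topspace T = UNIV"
  shows "eventually P (group_uniformity T) \<longleftrightarrow>
    (\<exists>U\<in>zero_nhds T. \<forall>x y. x - y \<in> U \<longrightarrow> P (x, y))"
proof -
  have "eventually P (group_uniformity T) \<longleftrightarrow>
      (\<exists>U\<in>zero_nhds T. eventually P (principal {(x, y). x - y \<in> U}))"
    unfolding group_uniformity_def
  proof (rule eventually_INF_base)
    show "zero_nhds T \<noteq> {}" using zero_nhds_UNIV[OF assms] by blast
  next
    fix U V assume "U \<in> zero_nhds T" "V \<in> zero_nhds T"
    then show "\<exists>W\<in>zero_nhds T. principal {(x, y). x - y \<in> W} \<le>
        inf (principal {(x, y). x - y \<in> U}) (principal {(x, y). x - y \<in> V})"
      by (intro bexI[of _ "U \<inter> V"] zero_nhds_Int) auto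
  qed
  then show ?thesis by (simp add: eventually_principal)
qed

lemma uniformity_topology_group_uniformity:
  fixes T :: "'a::ab_group_add topology"
  assumes T: "group_topology T"
  shows "uniformity_topology (group_uniformity T) = T"
proof -
  have top: "topspace T = UNIV" and cont: "continuous_map T T uminus"
    using T by (auto simp: group_topology_def)
  \<comment> \<open>The entourage of \<open>U\<close> cuts out the translate of \<open>- U\<close>
    at \<open>x\<close>, so neighbourhoods of \<open>0\<close> must be reflected.\<close>
  have uminus: "uminus ` U \<in> zero_nhds T" if U: "U \<in> zero_nhds T" for U
  proof -
    obtain V where V: "openin T V" "0 \<in> V" "V \<subseteq> U"
      using U by (auto simp: zero_nhds_def)
    have "openin T (uminus -` V)"
      using openin_continuous_map_preimage[OF cont V(1)] top by (simp add: vimage_def)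
    moreover have "uminus -` V \<subseteq> uminus ` U"
    proof
      fix x assume "x \<in> uminus -` V"
      then have "- x \<in> U" using V(3) by blast
      then show "x \<in> uminus ` U" by (metis imageI minus_minus)
    qed
    ultimately show ?thesis
      using V(2) unfolding zero_nhds_def by (auto intro!: exI[of _ "uminus -` V"])
  qed
  have "(\<forall>\<^sub>F (x', y) in group_uniformity T. x' = x \<longrightarrow> y \<in> W) \<longleftrightarrow>
      (\<exists>B\<in>zero_nhds T. (+) x ` B \<subseteq> W)" for x W
  proof
    assume "\<forall>\<^sub>F (x', y) in group_uniformity T. x' = x \<longrightarrow> y \<in> W"
    then obtain U where U: "U \<in> zero_nhds T" "\<And>y. x - y \<in> U \<Longrightarrow> y \<in> W"
      unfolding eventually_group_uniformity[OF top] by auto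
    then have "(+) x ` uminus ` U \<subseteq> W" by auto
    then show "\<exists>B\<in>zero_nhds T. (+) x ` B \<subseteq> W" using uminus[OF U(1)] by blast
  next
    assume "\<exists>B\<in>zero_nhds T. (+) x ` B \<subseteq> W"
    then obtain B where B: "B \<in> zero_nhds T" "(+) x ` B \<subseteq> W" by blast
    have "y \<in> W" if "x - y \<in> uminus ` B" for y
    proof -
      have "y - x \<in> B" using that by (metis imageE minus_diff_eq minus_minus)
      then have "x + (y - x) \<in> W" using B(2) by blast
      then show ?thesis by simp
    qed
    then show "\<forall>\<^sub>F (x', y) in group_uniformity T. x' = x \<longrightarrow> y \<in> W"
      unfolding eventually_group_uniformity[OF top] using uminus[OF B(1)] by auto
  qed
  then show ?thesis
    unfolding topology_eq openin_uniformity_topology openin_group_topology[OF T] by simp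
qed

text \<open>A smaller filter is a finer uniformity, hence has more open sets.\<close>

lemma uniformity_topology_mono:
  assumes "v \<le> u" "openin (uniformity_topology u) W"
  shows "openin (uniformity_topology v) W"
  unfolding openin_uniformity_topology
proof
  fix x assume "x \<in> W"
  with assms(2) have "\<forall>\<^sub>F (x', y) in u. x' = x \<longrightarrow> y \<in> W"
    unfolding openin_uniformity_topology by (rule bspec)
  with assms(1) show "\<forall>\<^sub>F (x', y) in v. x' = x \<longrightarrow> y \<in> W"
    by (rule filter_leD)
qed

lemma eventually_truncated_uniformity:
  assumes "(a, b) \<in> J" "eventually P u"
  shows "\<forall>\<^sub>F (x, y) in truncated_uniformity J u. P (truncation a b x, truncation a b y)"
proof -
  let ?f = "\<lambda>(x, y). (truncation a b x, truncation a b y)"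
  have "truncated_uniformity J u \<le> filtercomap ?f u"
    unfolding truncated_uniformity_def by (rule INF_lower2[OF assms(1)]) simp
  moreover have "eventually (\<lambda>p. P (?f p)) (filtercomap ?f u)"
    using assms(2) by (rule eventually_filtercomapI)
  ultimately have "eventually (\<lambda>p. P (?f p)) (truncated_uniformity J u)"
    by (rule filter_leD)
  then show ?thesis by (simp add: case_prod_unfold)
qed

section \<open>Comparison with the unbounded topology\<close>

text \<open>One truncation at a time suffices for an infimum. For the interval from \<open>a\<close>
  to \<open>b\<close> the neighbourhood is cut off at \<open>b - a\<close>, and the nonexpansive
  bound is uniform in \<open>x\<close> and \<open>y\<close>, so the uniformities themselves
  compare.\<close>

lemma group_uniformity_unbounded_le:
  fixes A :: "'a::lattice_ab_group_add_abs set"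
  assumes A: "solid_subgroup A" and T: "locally_solid_group_topology T"
  shows "group_uniformity (unbounded_topology A T) \<le>
    truncated_uniformity {(a, b). b - a \<in> positive_part A} (group_uniformity T)"
  unfolding truncated_uniformity_def
proof (rule INF_greatest, clarify)
  fix a b assume ab: "b - a \<in> positive_part A"
  have top: "topspace T = UNIV" "topspace (unbounded_topology A T) = UNIV"
    using T locally_solid_unbounded_topology[OF A T]
    by (simp_all add: locally_solid_group_topology_def group_topology_def)
  show "group_uniformity (unbounded_topology A T) \<le>
      filtercomap (\<lambda>(x, y). (truncation a b x, truncation a b y)) (group_uniformity T)"
  proof (rule filter_leI)
    fix P
    assume "eventually P
      (filtercomap (\<lambda>(x, y). (truncation a b x, truncation a b y)) (group_uniformity T))"
    then obtain U where U: "U \<in> zero_nhds T"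
      "\<And>x y. truncation a b x - truncation a b y \<in> U \<Longrightarrow> P (x, y)"
      unfolding eventually_filtercomap eventually_group_uniformity[OF top(1)] by fastforce
    obtain V where V: "V \<in> zero_nhds T" "solid V" "V \<subseteq> U"
      using zero_nhds_solid[OF T U(1)] .
    have le: "a \<le> b" using ab by (simp add: positive_part_def)
    have "P (x, y)" if "inf (\<bar>x - y\<bar>) (b - a) \<in> V" for x y
    proof -
      have "\<bar>truncation a b x - truncation a b y\<bar> \<le> \<bar>inf (\<bar>x - y\<bar>) (b - a)\<bar>"
        using truncation_diff_le[OF le] abs_ge_self by (rule order.trans)
      then show ?thesis using solidD[OF V(2) that] V(3) U(2) by blast
    qed
    moreover have "{z. inf (\<bar>z\<bar>) (b - a) \<in> V} \<in> zero_nhds (unbounded_topology A T)"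
      unfolding zero_nhds_unbounded_topology[OF A T] unbounded_base_def
      using ab V(1) by blast
    ultimately show "eventually P (group_uniformity (unbounded_topology A T))"
      unfolding eventually_group_uniformity[OF top(2)] by (intro bexI allI impI) auto
  qed
qed

text \<open>The two truncation intervals have \<open>x\<close> as an endpoint and so depend on
  \<open>x\<close>; this direction is therefore pointwise and compares topologies rather than
  uniformities.\<close>

lemma eventually_unbounded_base:
  fixes A :: "'a::lattice_ab_group_add_abs set"
  assumes T: "locally_solid_group_topology T" and B: "B \<in> unbounded_base A T"
  shows "\<forall>\<^sub>F (x', y) in
    truncated_uniformity {(a, b). b - a \<in> positive_part A} (group_uniformity T).
      x' = x \<longrightarrow> y - x \<in> B"
proof -
  have top: "topspace T = UNIV"
    using T by (simp add: locally_solid_group_topology_def group_topology_def)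
  obtain a U where a: "a \<in> positive_part A" and U: "U \<in> zero_nhds T"
    and B_eq: "B = {x. inf (\<bar>x\<bar>) a \<in> U}"
    using B by (auto simp: unbounded_base_def)
  have a0: "0 \<le> a" using a by (simp add: positive_part_def)
  \<comment> \<open>Solidity of \<open>V\<close> passes from the sum of the two displacements down
    to the meet it dominates; \<open>W\<close> allows forming that sum, and solidity of
    \<open>S\<close> allows changing signs.\<close>
  obtain V where V: "V \<in> zero_nhds T" "solid V" "V \<subseteq> U"
    using zero_nhds_solid[OF T U] .
  obtain W where W: "W \<in> zero_nhds T" "\<And>x y. x \<in> W \<Longrightarrow> y \<in> W \<Longrightarrow> x + y \<in> V"
    using zero_nhds_add[OF _ V(1)] T unfolding locally_solid_group_topology_def by metis
  obtain S where S: "S \<in> zero_nhds T" "solid S" "S \<subseteq> W"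
    using zero_nhds_solid[OF T W(1)] .
  have ev: "\<forall>\<^sub>F (x, y) in group_uniformity T. x - y \<in> S"
    unfolding eventually_group_uniformity[OF top] using S(1) by auto
  let ?u = "truncated_uniformity {(a, b). b - a \<in> positive_part A} (group_uniformity T)"
  \<comment> \<open>Both this pair of bounds and the next have difference \<open>a\<close>, so they
    are admissible truncations.\<close>
  have "\<forall>\<^sub>F (x', y) in ?u. truncation x (x + a) x' - truncation x (x + a) y \<in> S"
    using eventually_truncated_uniformity[OF _ ev, of x "x + a"] a by simp
  moreover have "\<forall>\<^sub>F (x', y) in ?u. truncation (x - a) x x' - truncation (x - a) x y \<in> S"
    using eventually_truncated_uniformity[OF _ ev, of "x - a" x] a by simp
  ultimately show ?thesis
  proof eventually_elim
    case (elim p)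
    obtain x' y where p: "p = (x', y)" by (cases p)
    have "y - x \<in> B" if "x' = x"
    proof -
      \<comment> \<open>Both truncations fix \<open>x\<close>, which is the lower endpoint of one
        interval and the upper endpoint of the other.\<close>
      have "x - truncation x (x + a) y \<in> S" and low: "x - truncation (x - a) x y \<in> S"
        using elim a0 that p by simp_all
      then have "truncation x (x + a) y - x \<in> S"
        using solidD[OF S(2)] by (metis abs_minus_commute order.refl)
      then have "(truncation x (x + a) y - x) + (x - truncation (x - a) x y) \<in> V"
        using low S(3) W(2) by blast
      moreover have "\<bar>inf (\<bar>y - x\<bar>) a\<bar> \<le>
          \<bar>(truncation x (x + a) y - x) + (x - truncation (x - a) x y)\<bar>"
        using abs_inf_le_truncations[OF a0, of y x] a0
        by (metis abs_ge_self abs_ge_zero abs_of_nonneg inf_greatest order.trans)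
      ultimately show ?thesis
        using solidD[OF V(2)] V(3) B_eq by blast
    qed
    then show ?case using p by simp
  qed
qed

theorem uniformity_topology_truncated_uniformity:
  fixes A :: "'a::lattice_ab_group_add_abs set"
  assumes A: "solid_subgroup A" and T: "locally_solid_group_topology T"
  shows "uniformity_topology
    (truncated_uniformity {(a, b). b - a \<in> positive_part A} (group_uniformity T)) =
      unbounded_topology A T"
    (is "uniformity_topology ?u = ?T")
  unfolding topology_eq
proof (intro allI iffI)
  fix W assume "openin (uniformity_topology ?u) W"
  \<comment> \<open>The group uniformity of \<open>?T\<close> is finer than \<open>?u\<close> and
    induces \<open>?T\<close> itself.\<close>
  then have "openin (uniformity_topology (group_uniformity ?T)) W"
    by (rule uniformity_topology_mono[OF group_uniformity_unbounded_le[OF A T]])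
  then show "openin ?T W"
    using locally_solid_unbounded_topology[OF A T]
    by (simp add: uniformity_topology_group_uniformity locally_solid_group_topology_def)
next
  fix W assume W: "openin ?T W"
  show "openin (uniformity_topology ?u) W"
    unfolding openin_uniformity_topology
  proof
    fix x assume "x \<in> W"
    then obtain B where B: "B \<in> unbounded_base A T" "(+) x ` B \<subseteq> W"
      using W unfolding openin_unbounded_topology[OF A T] by blast
    have W': "y \<in> W" if "y - x \<in> B" for y
    proof -
      have "x + (y - x) \<in> W" using B(2) that by blast
      then show ?thesis by simp
    qed
    show "\<forall>\<^sub>F (x', y) in ?u. x' = x \<longrightarrow> y \<in> W"
      using eventually_unbounded_base[OF T B(1), of x]
      by (rule eventually_mono) (simp add: W' split_beta)
  qed
qed

theorem theorem4p9:
  fixes \<tau> :: "'a::lattice_ab_group_add_abs topology"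
    and A :: "'a set"
    and u :: "('a \<times> 'a) filter"
    and J :: "('a \<times> 'a) set"
  assumes "locally_solid_group_topology \<tau>"
    and "Hausdorff_space \<tau>"
    and "solid_subgroup A"
    and "u = group_uniformity \<tau>"
    and "J = {(a, b). b - a \<in> positive_part A}"
  shows "uniformity_topology (truncated_uniformity J u) = unbounded_topology A \<tau> \<and>
    uniformity_topology (star_uniformity u) = unbounded_topology UNIV \<tau>"
proof
  show "uniformity_topology (truncated_uniformity J u) = unbounded_topology A \<tau>"
    using assms by (simp add: uniformity_topology_truncated_uniformity)
  \<comment> \<open>For \<open>A = UNIV\<close> the condition on \<open>b - a\<close> reduces to
    \<open>a \<le> b\<close>, which is the index set of \<open>star_uniformity\<close>.\<close>
  have "solid_subgroup (UNIV :: 'a set)"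
    by (simp add: solid_subgroup_def solid_def)
  from uniformity_topology_truncated_uniformity[OF this assms(1)]
  show "uniformity_topology (star_uniformity u) = unbounded_topology UNIV \<tau>"
    by (simp add: star_uniformity_def positive_part_def assms(4))
qed

end
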